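(* A finite bounded poset admits a generalized recursive atom ordering (GRAO) if and only if it admits a recursive atom ordering (RAO). Moreover, every RAO is a GRAO, while every GRAO may be transformed into an RAO by the atom reordering process: if the chain-atom ordering $\Lambda$ is a GRAO for a finite bounded poset $P$, then its atom reordering $\Lambda^{re}$ is an RAO for $P$.
   Context: Posets are finite and bounded ($\hat 0$, $\hat 1$), not necessarily graded. The atoms of $[u,v]$ are the elements of $[u,v]$ covering $u$. The length of a poset is the length (number of order relations) of its longest chain. A rooted interval $[u,v]_r$ is an interval with a root $r$, i.e. a saturated chain from $\hat 0$ to $u$. A chain-atom ordering $\Lambda$ of $P$ is a choice, for each rooted interval $[u,\hat 1]_r$, of a total order $\Lambda([u,\hat 1]_r)$ on its atoms. Its restriction $\Lambda|_{[u,v]_r}$ orders the atoms of each $[u',v]$ ($u\le u'<v$, with root extending $r$) by the order inherited from the corresponding interval $[u',\hat 1]$. RAOs and GRAOs are regarded as chain-atom orderings, as follows. RAO: $\Lambda$ is an RAO for $P$ if $P$ has length 1, or if, writing $a_1,\dots,a_t$ for the atoms of $P$ in the order given by $\Lambda$: (i)(a) for all $j$, the restriction of $\Lambda$ to $[a_j,\hat 1]$ is an RAO; (i)(b) for $j\ne 1$, the atoms of $[a_j,\hat 1]$ coming first in this RAO are those greater than some $a_k$ with $k<j$; (ii) for all $i<j$ and $y$ with $y>a_i$, $y>a_j$, there exist $k<j$ and $z\in P$ with $a_j\lessdot z$ and $a_k<z\le y$. GRAO: $\Lambda$ is a GRAO for $P$ if $P$ has length 1, or if $P$ has length greater than 1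 and: (i)(a) for all $j$, the restriction of $\Lambda$ to $[a_j,\hat 1]$ is a GRAO; (i)(b) for any atom $a_j$ and $x,w\in P$ with $a_j\lessdot x\lessdot w$, either the first atom of $[a_j,w]$ with respect to $\Lambda$ is above some $a_i$ with $i<j$, or no atom of $[a_j,w]$ is above any $a_i$ with $i<j$; (ii) for any $y\in P$ and atoms $a_i,a_j<y$ with $i<j$, there exist $z\le y$ and an atom $a_k$ with $k<j$ such that $a_j\lessdot z$ and $a_k<z$. $P$ admits an RAO (resp. GRAO) if some such chain-atom ordering exists. Atom reordering process: from a chain-atom ordering $\Lambda$, a chain-atom ordering $\Lambda^{re}$ (the atom reordering) is built from bottom to top (elements $u$ taken in the order of any linear extension of $P$). Set $\Lambda^{re}([\hat 0,\hat 1])=\Lambda([\hat 0,\hat 1])$. For $u\neq\hat 0$ and a root $r$ of $u$, let $u^-$ be the element of $r$ covered by $u$ and $r^-$ the root obtained from $r$ by deleting $u$. Let $F_r(u)$ be the set of atoms $a$ of $[u,\hat 1]_r$ with $a>a'$ in $P$ for some atom $a'$ of $[u^-,\hat 1]_{r^-}$ coming earlier than $u$ in the already determined order $\Lambda^{re}([u^-,\hat 1]_{r^-})$, and let $G_r(u)$ be the set of the other atoms of $[u,\hat 1]_r$. Then $\Lambda^{re}([u,\hat 1]_r)$ lists first all elements of $F_r(u)$, then all elements of $G_r(u)$, keeping within each of these sets the relative order of $\Lambda([u,\hat 1]_r)$. *)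

theory Defs
  imports Main
begin

text \<open>
  A finite bounded poset is a type of sort \<open>{finite, order_bot, order_top}\<close>, with
  \<open>bot\<close> and \<open>top\<close> as least and greatest elements. Its intervals are the sets \<open>{u..v}\<close>.
\<close>

definition covers :: "'a::order \<Rightarrow> 'a \<Rightarrow> bool"  (infix "\<lessdot>" 50) where
  "u \<lessdot> v \<longleftrightarrow> u < v \<and> \<not> (\<exists>w. u < w \<and> w < v)"

definition atoms :: "'a::order \<Rightarrow> 'a \<Rightarrow> 'a set" where
  "atoms u v = {a \<in> {u..v}. u \<lessdot> a}"

definition poset_length :: "'a::order set \<Rightarrow> nat" where
  "poset_length A =
     Max {card C - 1 | C. C \<subseteq> A \<and> C \<noteq> {} \<and> Complete_Partial_Order.chain (\<le>) C}"

text \<open>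
  A root of \<open>[u,v]\<close> is the list of elements, in increasing order, of a saturated chain from
  \<open>bot\<close> to \<open>u\<close>. Hence \<open>last r\<close> is \<open>u\<close>, \<open>butlast r\<close> is \<open>r\<close> with \<open>u\<close> deleted, and
  \<open>r @ [a]\<close> is the extension of \<open>r\<close> to a root of \<open>[a,v]\<close> for an atom \<open>a\<close> of \<open>[u,v]\<close>.
\<close>

definition is_root :: "'a::order_bot list \<Rightarrow> 'a \<Rightarrow> bool" where
  "is_root r u \<longleftrightarrow> r \<noteq> [] \<and> hd r = bot \<and> last r = u \<and> successively (\<lessdot>) r"

text \<open>
  The total order that \<open>\<Lambda>\<close> assigns to the atoms of \<open>[u,top]\<close> with root \<open>r\<close> is given as the list
  \<open>\<Lambda> r\<close> enumerating them in increasing order; \<open>\<Lambda> r\<close> is irrelevant if \<open>r\<close> is not a root.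
  Lists are indexed from 0, so \<open>\<Lambda> r ! 0\<close> is the first atom.
\<close>

definition chain_atom_ordering ::
    "('a::{finite,order_bot,order_top} list \<Rightarrow> 'a list) \<Rightarrow> bool" where
  "chain_atom_ordering \<Lambda> \<longleftrightarrow>
     (\<forall>u r. is_root r u \<longrightarrow> distinct (\<Lambda> r) \<and> set (\<Lambda> r) = atoms u top)"

text \<open>The order on the atoms of \<open>[u,v]\<close> with root \<open>r\<close> inherited from \<open>[u,top]\<close>.\<close>

definition restrict_order :: "('a::order list \<Rightarrow> 'a list) \<Rightarrow> 'a list \<Rightarrow> 'a \<Rightarrow> 'a list" where
  "restrict_order \<Lambda> r v = filter (\<lambda>a. a \<le> v) (\<Lambda> r)"

definition precedes :: "'b list \<Rightarrow> 'b \<Rightarrow> 'b \<Rightarrow> bool" where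
  "precedes xs x y \<longleftrightarrow> (\<exists>i j. i < j \<and> j < length xs \<and> xs ! i = x \<and> xs ! j = y)"

text \<open>
  For a root \<open>r\<close> of \<open>u\<close>, \<open>rao_at \<Lambda> r\<close> says that the restriction of \<open>\<Lambda>\<close> to \<open>[u,top]\<close> with
  root \<open>r\<close> is an RAO, and \<open>grao_at \<Lambda> r\<close> that it is a GRAO. The recursion is well-founded
  because the poset is finite. The one-point poset (length 0), on which there is nothing
  to order, is put into the base case; it never arises as \<open>[a,top]\<close> for an atom \<open>a\<close> of an
  interval of length greater than 1.
\<close>

inductive rao_at ::
    "('a::{finite,order_bot,order_top} list \<Rightarrow> 'a list) \<Rightarrow> 'a list \<Rightarrow> bool"
  for \<Lambda> where
  rao_base: "poset_length {last r..top} \<le> 1 \<Longrightarrow> rao_at \<Lambda> r"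
| rao_step:
  "\<lbrakk> \<And>j. j < length (\<Lambda> r) \<Longrightarrow> rao_at \<Lambda> (r @ [\<Lambda> r ! j]);
     \<And>j x y. \<lbrakk> j < length (\<Lambda> r); j \<noteq> 0;
        x \<in> atoms (\<Lambda> r ! j) top; \<exists>k<j. \<Lambda> r ! k < x;
        y \<in> atoms (\<Lambda> r ! j) top; \<not> (\<exists>k<j. \<Lambda> r ! k < y) \<rbrakk>
        \<Longrightarrow> precedes (\<Lambda> (r @ [\<Lambda> r ! j])) x y;
     \<And>i j y. \<lbrakk> i < j; j < length (\<Lambda> r); \<Lambda> r ! i < y; \<Lambda> r ! j < y \<rbrakk>
        \<Longrightarrow> \<exists>k<j. \<exists>z. \<Lambda> r ! j \<lessdot> z \<and> \<Lambda> r ! k < z \<and> z \<le> y \<rbrakk>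
   \<Longrightarrow> rao_at \<Lambda> r"

inductive grao_at ::
    "('a::{finite,order_bot,order_top} list \<Rightarrow> 'a list) \<Rightarrow> 'a list \<Rightarrow> bool"
  for \<Lambda> where
  grao_base: "poset_length {last r..top} \<le> 1 \<Longrightarrow> grao_at \<Lambda> r"
| grao_step:
  "\<lbrakk> poset_length {last r..top} > 1;
     \<And>j. j < length (\<Lambda> r) \<Longrightarrow> grao_at \<Lambda> (r @ [\<Lambda> r ! j]);
     \<And>j x w. \<lbrakk> j < length (\<Lambda> r); \<Lambda> r ! j \<lessdot> x; x \<lessdot> w \<rbrakk>
        \<Longrightarrow> (\<exists>i<j. \<Lambda> r ! i < hd (restrict_order \<Lambda> (r @ [\<Lambda> r ! j]) w)) \<or>
            \<not> (\<exists>b \<in> atoms (\<Lambda> r ! j) w. \<exists>i<j. \<Lambda> r ! i < b);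
     \<And>i j y. \<lbrakk> i < j; j < length (\<Lambda> r); \<Lambda> r ! i < y; \<Lambda> r ! j < y \<rbrakk>
        \<Longrightarrow> \<exists>z k. z \<le> y \<and> k < j \<and> \<Lambda> r ! j \<lessdot> z \<and> \<Lambda> r ! k < z \<rbrakk>
   \<Longrightarrow> grao_at \<Lambda> r"

definition RAO :: "('a::{finite,order_bot,order_top} list \<Rightarrow> 'a list) \<Rightarrow> bool" where
  "RAO \<Lambda> \<longleftrightarrow> chain_atom_ordering \<Lambda> \<and> rao_at \<Lambda> [bot]"

definition GRAO :: "('a::{finite,order_bot,order_top} list \<Rightarrow> 'a list) \<Rightarrow> bool" where
  "GRAO \<Lambda> \<longleftrightarrow> chain_atom_ordering \<Lambda> \<and> grao_at \<Lambda> [bot]"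

text \<open>
  The atom reordering of \<open>\<Lambda>\<close>. Since the order at a root \<open>r\<close> of \<open>u\<close> depends only on the order
  at \<open>butlast r\<close>, the construction from bottom to top is a recursion on the length of \<open>r\<close>.
  \<open>last (butlast r)\<close> is the element of \<open>r\<close> covered by \<open>u\<close>.
\<close>

function reorder :: "('a::order list \<Rightarrow> 'a list) \<Rightarrow> 'a list \<Rightarrow> 'a list" where
  "reorder \<Lambda> r =
     (if length r \<le> 1 then \<Lambda> r
      else let F = {a \<in> set (\<Lambda> r). \<exists>a'. precedes (reorder \<Lambda> (butlast r)) a' (last r) \<and> a' < a}
           in filter (\<lambda>a. a \<in> F) (\<Lambda> r) @ filter (\<lambda>a. a \<notin> F) (\<Lambda> r))"
  by pat_completeness auto
termination
  by (relation "measure (\<lambda>(\<Lambda>, r). length r)") auto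

declare reorder.simps [simp del]

end

theory Submission
  imports Defs
begin

text \<open>
  The crux is that condition (i)(b) of a GRAO, which speaks about \<open>\<Lambda>\<close>, survives the passage
  to the reordering of the level below: for every root \<open>r\<close> of \<open>u\<close>, if \<open>x\<close> is among the atoms
  \<open>F\<^sub>r(u)\<close> that the reordering puts first and \<open>w\<close> covers \<open>x\<close>, then the \<open>\<Lambda>\<close>-first atom of
  \<open>[u,w]\<close> lies in \<open>F\<^sub>r(u)\<close> as well. This goes by induction on \<open>r\<close>. Condition (ii) for the
  reordering follows from it, since an atom \<open>c\<close> produced by condition (ii) of the GRAO below a
  cover \<open>z\<close> of an atom in \<open>F\<^sub>r(u)\<close> may be replaced by the first atom of \<open>[u,z]\<close>.
\<close>

section \<open>Precedence in lists\<close>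

lemma precedes_Nil [simp]: "\<not> precedes [] x y"
  by (simp add: precedes_def)

lemma precedes_Cons [simp]:
  "precedes (z # xs) x y \<longleftrightarrow> z = x \<and> y \<in> set xs \<or> precedes xs x y"
proof
  assume "precedes (z # xs) x y"
  then obtain i j where ij: "i < j" "j < Suc (length xs)" "(z # xs) ! i = x" "(z # xs) ! j = y"
    by (auto simp: precedes_def)
  then obtain j' where j': "j = Suc j'" by (cases j) auto
  show "z = x \<and> y \<in> set xs \<or> precedes xs x y"
  proof (cases i)
    case 0
    with ij j' show ?thesis by auto
  next
    case (Suc i')
    with ij j' show ?thesis unfolding precedes_def by auto
  qed
next
  assume "z = x \<and> y \<in> set xs \<or> precedes xs x y"
  then show "precedes (z # xs) x y"
  proof
    assume "z = x \<and> y \<in> set xs"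
    then obtain j where "z = x" "j < length xs" "xs ! j = y" by (auto simp: in_set_conv_nth)
    then show ?thesis unfolding precedes_def by (intro exI[of _ 0] exI[of _ "Suc j"]) auto
  next
    assume "precedes xs x y"
    then obtain i j where "i < j" "j < length xs" "xs ! i = x" "xs ! j = y"
      by (auto simp: precedes_def)
    then show ?thesis unfolding precedes_def by (intro exI[of _ "Suc i"] exI[of _ "Suc j"]) auto
  qed
qed

lemma precedes_set: "precedes xs x y \<Longrightarrow> x \<in> set xs \<and> y \<in> set xs"
  by (induction xs) auto

lemma precedes_append:
  "precedes (xs @ ys) x y \<longleftrightarrow>
     precedes xs x y \<or> precedes ys x y \<or> x \<in> set xs \<and> y \<in> set ys"
  by (induction xs) auto

lemma precedes_filter: "precedes (filter P xs) x y \<longleftrightarrow> P x \<and> P y \<and> precedes xs x y"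
  by (induction xs) auto

lemma precedes_total:
  "x \<in> set xs \<Longrightarrow> y \<in> set xs \<Longrightarrow> x \<noteq> y \<Longrightarrow> precedes xs x y \<or> precedes xs y x"
  by (induction xs) auto

lemma precedes_irrefl: "distinct xs \<Longrightarrow> \<not> precedes xs x x"
  by (induction xs) auto

lemma precedes_trans:
  "distinct xs \<Longrightarrow> precedes xs x y \<Longrightarrow> precedes xs y z \<Longrightarrow> precedes xs x z"
  by (induction xs) (auto dest: precedes_set)

text \<open>Bridges the index form \<open>\<exists>k<j\<close> of the definitions and
  \<open>precedes\<close>; distinctness makes \<open>j\<close> the only position of
  \<open>xs ! j\<close>.\<close>

lemma precedes_nth:
  assumes "distinct xs" "j < length xs"
  shows "precedes xs x (xs ! j) \<longleftrightarrow> (\<exists>i<j. xs ! i = x)"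
  using assms by (auto simp: precedes_def nth_eq_iff_index_eq)

lemma hd_filter_in:
  assumes "x \<in> set xs" "P x"
  shows "hd (filter P xs) \<in> set xs" "P (hd (filter P xs))"
proof -
  have "filter P xs \<noteq> []" using assms by (auto simp: filter_empty_conv)
  then have "hd (filter P xs) \<in> set (filter P xs)" by (rule hd_in_set)
  then show "hd (filter P xs) \<in> set xs" "P (hd (filter P xs))" by auto
qed

lemma hd_filter_first:
  "x \<in> set xs \<Longrightarrow> P x \<Longrightarrow> hd (filter P xs) = x \<or> precedes xs (hd (filter P xs)) x"
  by (induction xs) auto

section \<open>Roots and short intervals\<close>

lemma mem_atoms_top [simp]: "a \<in> atoms u (top::'a::order_top) \<longleftrightarrow> u \<lessdot> a"
  by (auto simp: atoms_def covers_def)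

lemma is_root_bot: "is_root [bot] bot"
  by (simp add: is_root_def)

lemma is_root_snoc: "is_root (r @ [a]) a \<longleftrightarrow> (if r = [] then a = bot else is_root r (last r) \<and> last r \<lessdot> a)"
  by (auto simp: is_root_def successively_append_iff)

text \<open>The chain \<open>{u, a, b}\<close> is the witness. This excludes the base case of
  \<open>grao_at\<close> once an atom has something above it.\<close>

lemma poset_length_ge_2:
  fixes u :: "'a::{finite,order_top}"
  assumes "u < a" "a < b"
  shows "poset_length {u..top} \<ge> 2"
proof -
  let ?S = "{card C - 1 | C. C \<subseteq> {u..top} \<and> C \<noteq> {} \<and> Complete_Partial_Order.chain (\<le>) C}"
  have "card {u, a, b} = 3" using assms order.strict_trans[OF assms] by (auto simp: card_insert_if)
  moreover have "Complete_Partial_Order.chain (\<le>) {u, a, b}"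
    using assms by (auto simp: chain_def)
  ultimately have "2 \<in> ?S"
    using assms by (intro CollectI exI[of _ "{u, a, b}"]) auto
  moreover have "finite ?S" by simp
  ultimately show ?thesis unfolding poset_length_def by (rule Max_ge[rotated])
qed

lemma poset_length_top: "poset_length {top::'a::{finite,order_top}..top} \<le> 1"
proof -
  let ?S = "{card C - 1 | C. C \<subseteq> {top::'a..top} \<and> C \<noteq> {} \<and> Complete_Partial_Order.chain (\<le>) C}"
  have "card C - 1 \<le> 1" if "C \<subseteq> {top::'a..top}" for C
    using card_mono[OF _ that] by simp
  then have "\<forall>n\<in>?S. n \<le> 1" by blast
  moreover have "0 \<in> ?S"
    by (intro CollectI exI[of _ "{top::'a}"]) (auto simp: chain_def)
  then have "?S \<noteq> {}" by blast
  moreover have "finite ?S" by simp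
  ultimately show ?thesis unfolding poset_length_def by (subst Max_le_iff) auto
qed

section \<open>Recursive atom orderings are generalized recursive atom orderings\<close>

text \<open>Only (i)(b) needs an argument: an RAO lists the atoms above an earlier atom first, so if
  \<open>[a_j, w]\<close> contains such an atom, its first atom is one too.\<close>

lemma rao_at_imp_grao_at:
  assumes "chain_atom_ordering \<Lambda>" "rao_at \<Lambda> r" "is_root r u"
  shows "grao_at \<Lambda> r"
  using assms(2,3)
proof (induction arbitrary: u)
  case (rao_base r)
  show ?case using rao_base.hyps by (rule grao_base)
next
  case (rao_step r)
  show ?case
  \<comment> \<open>\<open>rao_step\<close> may also have been applied to a short interval, whereas
    \<open>grao_step\<close> demands length above 1.\<close>
  proof (cases "poset_length {last r..top} \<le> 1")
    case True
    then show ?thesis by (rule grao_base)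
  next
    case False
    have set_r: "set (\<Lambda> r) = atoms u top"
      using assms(1) rao_step.prems by (auto simp: chain_atom_ordering_def)
    have root: "is_root (r @ [\<Lambda> r ! j]) (\<Lambda> r ! j)" if "j < length (\<Lambda> r)" for j
      using nth_mem[OF that] rao_step.prems set_r by (auto simp: is_root_def successively_append_iff)
    show ?thesis
    proof (rule grao_step)
      show "poset_length {last r..top} > 1" using False by simp
      show "grao_at \<Lambda> (r @ [\<Lambda> r ! j])" if "j < length (\<Lambda> r)" for j
        using rao_step.IH[OF that root[OF that]] .
      show "(\<exists>i<j. \<Lambda> r ! i < hd (restrict_order \<Lambda> (r @ [\<Lambda> r ! j]) w)) \<or>
            \<not> (\<exists>b \<in> atoms (\<Lambda> r ! j) w. \<exists>i<j. \<Lambda> r ! i < b)"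
        if j: "j < length (\<Lambda> r)" and "\<Lambda> r ! j \<lessdot> x" "x \<lessdot> w" for j x w
      proof (rule disjCI)
        let ?L = "\<Lambda> (r @ [\<Lambda> r ! j])"
        assume "\<not> \<not> (\<exists>b \<in> atoms (\<Lambda> r ! j) w. \<exists>i<j. \<Lambda> r ! i < b)"
        then obtain b i where b: "b \<in> atoms (\<Lambda> r ! j) w" "i < j" "\<Lambda> r ! i < b" by blast
        have L: "distinct ?L" "set ?L = atoms (\<Lambda> r ! j) top"
          using assms(1) root[OF j] by (auto simp: chain_atom_ordering_def)
        have bL: "b \<in> set ?L" "b \<le> w" using b L by (auto simp: atoms_def)
        let ?h = "hd (restrict_order \<Lambda> (r @ [\<Lambda> r ! j]) w)"
        have h: "?h \<in> set ?L" "?h = b \<or> precedes ?L ?h b"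
          unfolding restrict_order_def
          using hd_filter_in(1)[of b ?L "\<lambda>a. a \<le> w"] hd_filter_first[of b ?L "\<lambda>a. a \<le> w"] bL
          by auto
        show "\<exists>i<j. \<Lambda> r ! i < ?h"
        proof (rule ccontr)
          assume no: "\<not> (\<exists>i<j. \<Lambda> r ! i < ?h)"
          \<comment> \<open>RAO condition (i)(b) puts \<open>b\<close> strictly before
            \<open>?h\<close>, although \<open>?h\<close> comes first among the atoms below
            \<open>w\<close>.\<close>
          have "precedes ?L b ?h"
            using rao_step.hyps(2)[of j b ?h] j b bL h no L by auto
          then show False using h(2) L(1) precedes_trans precedes_irrefl by metis
        qed
      qed
      show "\<exists>z k. z \<le> y \<and> k < j \<and> \<Lambda> r ! j \<lessdot> z \<and> \<Lambda> r ! k < z"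
        if "i < j" "j < length (\<Lambda> r)" "\<Lambda> r ! i < y" "\<Lambda> r ! j < y" for i j y
        using rao_step.hyps(3)[OF that] by blast
    qed
  qed
qed

lemma RAO_imp_GRAO: "RAO \<Lambda> \<Longrightarrow> GRAO \<Lambda>"
  using rao_at_imp_grao_at is_root_bot by (auto simp: RAO_def GRAO_def)

section \<open>The atom reordering of a generalized recursive atom ordering\<close>

text \<open>
  The set \<open>F\<^sub>r(u)\<close> of the atom reordering process. It is empty for the root of \<open>bot\<close>, so that the
  description of \<open>reorder\<close> below needs no case distinction.
\<close>

definition front :: "('a::order list \<Rightarrow> 'a list) \<Rightarrow> 'a list \<Rightarrow> 'a set" where
  "front \<Lambda> r = {a \<in> set (\<Lambda> r). 1 < length r \<and>
     (\<exists>a'. precedes (reorder \<Lambda> (butlast r)) a' (last r) \<and> a' < a)}"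

lemma reorder_front:
  "reorder \<Lambda> r = filter (\<lambda>a. a \<in> front \<Lambda> r) (\<Lambda> r) @ filter (\<lambda>a. a \<notin> front \<Lambda> r) (\<Lambda> r)"
  by (subst reorder.simps) (auto simp: front_def Let_def intro!: filter_cong)

lemma set_reorder [simp]: "set (reorder \<Lambda> r) = set (\<Lambda> r)"
  by (auto simp: reorder_front)

lemma distinct_reorder: "distinct (\<Lambda> r) \<Longrightarrow> distinct (reorder \<Lambda> r)"
  by (auto simp: reorder_front)

lemma precedes_reorder:
  "precedes (reorder \<Lambda> r) x y \<longleftrightarrow>
     (x \<in> front \<Lambda> r \<longleftrightarrow> y \<in> front \<Lambda> r) \<and> precedes (\<Lambda> r) x y \<or>
     x \<in> front \<Lambda> r \<and> y \<in> set (\<Lambda> r) - front \<Lambda> r"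
  unfolding reorder_front by (auto simp: precedes_append precedes_filter front_def)

lemma front_snoc:
  "r \<noteq> [] \<Longrightarrow> front \<Lambda> (r @ [u]) =
     {a \<in> set (\<Lambda> (r @ [u])). \<exists>a'. precedes (reorder \<Lambda> r) a' u \<and> a' < a}"
  by (cases r) (auto simp: front_def)

lemma chain_atom_ordering_reorder:
  "chain_atom_ordering \<Lambda> \<Longrightarrow> chain_atom_ordering (reorder \<Lambda>)"
  by (simp add: chain_atom_ordering_def distinct_reorder)

section \<open>The GRAO conditions at an arbitrary root\<close>

locale grao =
  fixes \<Lambda> :: "'a::{finite,order_bot,order_top} list \<Rightarrow> 'a list"
  assumes GRAO: "GRAO \<Lambda>"
begin

lemma distinct_order: "is_root r u \<Longrightarrow> distinct (\<Lambda> r)"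
  and set_order: "is_root r u \<Longrightarrow> set (\<Lambda> r) = atoms u top"
  using GRAO by (auto simp: GRAO_def chain_atom_ordering_def)

lemma root_extend:
  assumes "is_root r u" "a \<in> set (\<Lambda> r)"
  shows "is_root (r @ [a]) a"
  using assms set_order[OF assms(1)] by (auto simp: is_root_def successively_append_iff)

lemma root_cases:
  assumes "is_root r u"
  obtains "r = [bot]" "u = bot"
  | r' u' where "r = r' @ [u]" "is_root r' u'" "u' \<lessdot> u"
proof -
  have r: "r = butlast r @ [u]" using assms append_butlast_last_id unfolding is_root_def by metis
  then have root: "is_root (butlast r @ [u]) u" using assms by metis
  show thesis
  proof (cases "butlast r = []")
    case True
    then show thesis using that(1) r root by (simp add: is_root_def)
  next
    case False
    then show thesis using that(2)[OF r] root by (auto simp: is_root_snoc)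
  qed
qed

text \<open>The base case carries no recursive information, but there the atom \<open>a\<close> must
  be \<open>top\<close>, and the one-point interval falls under the base case again.\<close>

lemma grao_at_extend:
  assumes root: "is_root r u" and "grao_at \<Lambda> r" and a: "a \<in> set (\<Lambda> r)"
  shows "grao_at \<Lambda> (r @ [a])"
  using assms(2)
proof cases
  case grao_base
  have ua: "u < a" "last r = u"
    using a root set_order[OF root] by (auto simp: covers_def is_root_def)
  have "a = top"
  proof (rule ccontr)
    assume "a \<noteq> top"
    then have "a < top" by (simp add: less_top)
    then show False using poset_length_ge_2[OF ua(1)] grao_base ua(2) by simp
  qed
  then show ?thesis using poset_length_top by (intro grao_at.grao_base) auto
next
  case grao_step
  then show ?thesis using a by (auto simp: in_set_conv_nth)
qed

lemma grao_at_root: "is_root r u \<Longrightarrow> grao_at \<Lambda> r"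
proof (induction r arbitrary: u rule: rev_induct)
  case Nil
  then show ?case by (simp add: is_root_def)
next
  case (snoc a r)
  from snoc.prems show ?case
  proof (cases rule: root_cases)
    case 1
    then show ?thesis using GRAO by (simp add: GRAO_def)
  next
    case (2 r' u')
    then show ?thesis using snoc.IH set_order by (auto intro!: grao_at_extend)
  qed
qed

text \<open>Condition (i)(b) with its second alternative ruled out: \<open>x\<close> is an atom of
  \<open>[a,w]\<close> above the earlier \<open>c\<close>.\<close>

lemma first_above_earlier:
  assumes root: "is_root r u" and a: "a \<lessdot> x" "x \<lessdot> w"
    and c: "precedes (\<Lambda> r) c a" "c < x"
  obtains d where "precedes (\<Lambda> r) d a" "d < hd (restrict_order \<Lambda> (r @ [a]) w)"
proof -
  have ua: "u < a" "last r = u"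
    using precedes_set[OF c(1)] root set_order[OF root] by (auto simp: covers_def is_root_def)
  obtain j where j: "j < length (\<Lambda> r)" "a = \<Lambda> r ! j"
    using precedes_set[OF c(1)] by (auto simp: in_set_conv_nth)
  obtain i where i: "i < j" "\<Lambda> r ! i = c"
    using c(1) precedes_nth[OF distinct_order[OF root] j(1)] j(2) by auto
  have "x \<in> atoms a w" using a by (auto simp: atoms_def covers_def)
  from grao_at_root[OF root] have "\<exists>i<j. \<Lambda> r ! i < hd (restrict_order \<Lambda> (r @ [a]) w)"
  proof cases
    case grao_base
    then show ?thesis using poset_length_ge_2[OF ua(1), of x] a ua(2) by (simp add: covers_def)
  next
    case grao_step
    then show ?thesis using grao_step(3)[of j x w] j i c a \<open>x \<in> atoms a w\<close> by blast
  qed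
  then show thesis
    using that j precedes_nth[OF distinct_order[OF root] j(1)] by blast
qed

text \<open>Condition (ii) in terms of precedence; the chain from \<open>u\<close> through
  \<open>b\<close> to \<open>y\<close> excludes the base case.\<close>

lemma earlier_below_cover:
  assumes root: "is_root r u" and ab: "precedes (\<Lambda> r) a b" "a < y" "b < y"
  obtains z c where "z \<le> y" "b \<lessdot> z" "precedes (\<Lambda> r) c b" "c < z"
proof -
  have ub: "u < b" "last r = u"
    using precedes_set[OF ab(1)] root set_order[OF root] by (auto simp: covers_def is_root_def)
  obtain j where j: "j < length (\<Lambda> r)" "b = \<Lambda> r ! j"
    using precedes_set[OF ab(1)] by (auto simp: in_set_conv_nth)
  obtain i where i: "i < j" "\<Lambda> r ! i = a"
    using ab(1) precedes_nth[OF distinct_order[OF root] j(1)] j(2) by auto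
  from grao_at_root[OF root] have "\<exists>z k. z \<le> y \<and> k < j \<and> b \<lessdot> z \<and> \<Lambda> r ! k < z"
  proof cases
    case grao_base
    then show ?thesis using poset_length_ge_2[OF ub(1), of y] ab ub(2) by simp
  next
    case grao_step
    then show ?thesis using grao_step(4)[of i j y] j i ab by blast
  qed
  then show thesis
    using that j precedes_nth[OF distinct_order[OF root] j(1)] by blast
qed

text \<open>A mixed form of (i)(b): "earlier" refers to the reordering one level below, "first"
  still to \<open>\<Lambda>\<close>.\<close>

definition first_in_front :: "'a list \<Rightarrow> bool" where
  "first_in_front r \<longleftrightarrow>
     (\<forall>x w. x \<in> front \<Lambda> r \<longrightarrow> x \<lessdot> w \<longrightarrow> hd (restrict_order \<Lambda> r w) \<in> front \<Lambda> r)"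

text \<open>The witness is the \<open>\<Lambda>\<close>-first atom of \<open>[u,z]\<close>: the
  invariant at \<open>b\<close> puts it in the front, and it is \<open>c\<close> or comes before
  \<open>c\<close>.\<close>

lemma front_replace:
  assumes root: "is_root r u" and A: "first_in_front r"
    and b: "b \<in> front \<Lambda> r" "b \<lessdot> z" and c: "precedes (\<Lambda> r) c b" "c < z"
  obtains d where "d \<in> front \<Lambda> r" "precedes (\<Lambda> r) d b" "d < z"
proof -
  let ?d = "hd (restrict_order \<Lambda> r z)"
  have d: "?d \<in> front \<Lambda> r" using A b by (auto simp: first_in_front_def)
  have "?d \<in> set (\<Lambda> r)" "?d \<le> z" "?d = c \<or> precedes (\<Lambda> r) ?d c"
    using precedes_set[OF c(1)] c(2) hd_filter_in[of c "\<Lambda> r" "\<lambda>a. a \<le> z"]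
      hd_filter_first[of c "\<Lambda> r" "\<lambda>a. a \<le> z"]
    by (auto simp: restrict_order_def)
  \<comment> \<open>Since \<open>b\<close> lies strictly between \<open>u\<close> and
    \<open>z\<close>, the atom \<open>?d\<close> differs from \<open>z\<close>, so
    \<open>?d \<le> z\<close> is strict.\<close>
  moreover have "\<not> u \<lessdot> z"
    using precedes_set[OF c(1)] b set_order[OF root] by (auto simp: covers_def)
  ultimately have "precedes (\<Lambda> r) ?d b" "?d < z"
    using precedes_trans[OF distinct_order[OF root]] c(1) set_order[OF root]
    by (auto simp: order_le_less)
  with d show thesis using that by blast
qed

text \<open>The reordering may have moved \<open>a\<close> ahead of \<open>b\<close>. Then the
  \<open>\<Lambda>\<close>-first front atom \<open>e\<close> below \<open>y\<close> serves: if
  \<open>b\<close> preceded \<open>e\<close>, condition (ii) and \<open>front_replace\<close> would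
  give a still earlier front atom below \<open>y\<close>.\<close>

lemma earlier_if_not_front:
  assumes root: "is_root r u" and A: "first_in_front r"
    and ab: "precedes (reorder \<Lambda> r) a b" "a < y" "b < y" and b: "b \<notin> front \<Lambda> r"
  obtains c where "precedes (\<Lambda> r) c b" "c < y"
proof (cases "precedes (\<Lambda> r) a b")
  case True
  then show thesis using that ab by blast
next
  case False
  note dist = distinct_order[OF root]
  have a: "a \<in> front \<Lambda> r" using False ab b by (auto simp: precedes_reorder)
  let ?P = "\<lambda>a. a \<in> front \<Lambda> r \<and> a < y"
  define e where "e = hd (filter ?P (\<Lambda> r))"
  have aL: "a \<in> set (\<Lambda> r)" "b \<in> set (\<Lambda> r)" using precedes_set[OF ab(1)] by auto
  have e: "e \<in> set (\<Lambda> r)" "e \<in> front \<Lambda> r" "e < y"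
    using hd_filter_in[of a "\<Lambda> r" ?P] a ab aL by (auto simp: e_def)
  have e_first: "e = d \<or> precedes (\<Lambda> r) e d" if "d \<in> front \<Lambda> r" "d < y" for d
    using hd_filter_first[of d "\<Lambda> r" ?P] that by (auto simp: e_def front_def)
  have "\<not> precedes (\<Lambda> r) b e"
  proof
    assume "precedes (\<Lambda> r) b e"
    then obtain z c where z: "z \<le> y" "e \<lessdot> z" "precedes (\<Lambda> r) c e" "c < z"
      using earlier_below_cover[OF root] ab(3) e(3) by metis
    then obtain d where "d \<in> front \<Lambda> r" "precedes (\<Lambda> r) d e" "d < z"
      using front_replace[OF root A e(2)] by metis
    then show False
      using e_first[of d] z(1) precedes_trans[OF dist] precedes_irrefl[OF dist]
      by (metis order_less_le_trans)
  qed
  then have "precedes (\<Lambda> r) e b"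
    using precedes_total[OF e(1) aL(2)] e(2) b by auto
  then show thesis using that e(3) by blast
qed

text \<open>Translate "earlier than \<open>u'\<close>" from the reordering to
  \<open>\<Lambda>\<close>, apply (i)(b) there, and translate back.\<close>

lemma first_in_front_extend:
  assumes root: "is_root r u" and A: "first_in_front r" and u': "u \<lessdot> u'"
  shows "first_in_front (r @ [u'])"
  unfolding first_in_front_def
proof (intro allI impI)
  let ?r = "r @ [u']"
  fix x w
  assume x: "x \<in> front \<Lambda> ?r" and w: "x \<lessdot> w"
  have r: "r \<noteq> []" using root by (simp add: is_root_def)
  have u'L: "u' \<in> set (\<Lambda> r)" using u' set_order[OF root] by simp
  have root': "is_root ?r u'" using root_extend[OF root u'L] .
  obtain a where a: "precedes (reorder \<Lambda> r) a u'" "a < x" and xL: "x \<in> set (\<Lambda> ?r)"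
    using x r by (auto simp: front_snoc)
  have u'x: "u' \<lessdot> x" using xL set_order[OF root'] by simp
  obtain c where c: "precedes (\<Lambda> r) c u'" "c < x"
  proof (cases "u' \<in> front \<Lambda> r")
    case True
    then show thesis using that a by (auto simp: precedes_reorder)
  next
    case False
    then show thesis using earlier_if_not_front[OF root A a] that u'x by (auto simp: covers_def)
  qed
  define d where "d = hd (restrict_order \<Lambda> ?r w)"
  obtain e where e: "precedes (\<Lambda> r) e u'" "e < d"
    using first_above_earlier[OF root u'x w c] unfolding d_def by metis
  have dL: "d \<in> set (\<Lambda> ?r)"
    using hd_filter_in(1)[of x "\<Lambda> ?r" "\<lambda>a. a \<le> w"] xL w
    by (auto simp: d_def restrict_order_def covers_def)
  \<comment> \<open>If \<open>u'\<close> is in the front, \<open>e\<close> may have been moved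
    behind it; a front atom below \<open>d\<close> replaces it. Otherwise \<open>e\<close> stays
    ahead of \<open>u'\<close>.\<close>
  have "\<exists>f. precedes (reorder \<Lambda> r) f u' \<and> f < d"
  proof (cases "u' \<in> front \<Lambda> r")
    case True
    moreover have "u' \<lessdot> d" using dL set_order[OF root'] by simp
    ultimately obtain f where "f \<in> front \<Lambda> r" "precedes (\<Lambda> r) f u'" "f < d"
      using front_replace[OF root A] e by metis
    then show ?thesis using True by (auto simp: precedes_reorder)
  next
    case False
    then have "precedes (reorder \<Lambda> r) e u'" using e(1) u'L by (auto simp: precedes_reorder)
    then show ?thesis using e(2) by blast
  qed
  then show "hd (restrict_order \<Lambda> ?r w) \<in> front \<Lambda> ?r"
    using dL r by (auto simp: front_snoc d_def)
qed

lemma first_in_front_root: "is_root r u \<Longrightarrow> first_in_front r"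
proof (induction r arbitrary: u rule: rev_induct)
  case Nil
  then show ?case by (simp add: is_root_def)
next
  case (snoc a r)
  from snoc.prems show ?case
  proof (cases rule: root_cases)
    case 1
    then show ?thesis by (simp add: first_in_front_def front_def)
  next
    case (2 r' u')
    then show ?thesis using snoc.IH first_in_front_extend by auto
  qed
qed

text \<open>Condition (ii) for the reordering. For \<open>b\<close> in the front, the atom given by
  (ii) for \<open>\<Lambda>\<close> is exchanged for a front atom; for other \<open>b\<close>, every
  \<open>\<Lambda>\<close>-predecessor remains a predecessor.\<close>

lemma reorder_earlier_below_cover:
  assumes root: "is_root r u" and ab: "precedes (reorder \<Lambda> r) a b" "a < y" "b < y"
  obtains z c where "z \<le> y" "b \<lessdot> z" "precedes (reorder \<Lambda> r) c b" "c < z"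
proof (cases "b \<in> front \<Lambda> r")
  case True
  note A = first_in_front_root[OF root]
  have "precedes (\<Lambda> r) a b" using True ab by (auto simp: precedes_reorder)
  then obtain z c where z: "z \<le> y" "b \<lessdot> z" "precedes (\<Lambda> r) c b" "c < z"
    using earlier_below_cover[OF root] ab by metis
  obtain d where "d \<in> front \<Lambda> r" "precedes (\<Lambda> r) d b" "d < z"
    using front_replace[OF root A True z(2-4)] .
  then show thesis using that z True by (auto simp: precedes_reorder)
next
  case False
  obtain c where "precedes (\<Lambda> r) c b" "c < y"
    using earlier_if_not_front[OF root first_in_front_root[OF root] ab False] .
  then obtain z c where z: "z \<le> y" "b \<lessdot> z" "precedes (\<Lambda> r) c b" "c < z"
    using earlier_below_cover[OF root] ab by metis
  have "precedes (reorder \<Lambda> r) c b"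
    using z(3) False precedes_set[OF z(3)] by (auto simp: precedes_reorder)
  then show thesis using that z by blast
qed

lemma rao_at_reorder: "is_root r u \<Longrightarrow> rao_at (reorder \<Lambda>) r"
proof (induction "card {u..}" arbitrary: r u rule: less_induct)
  case less
  note root = less.prems
  let ?L = "reorder \<Lambda> r"
  have L: "distinct ?L" "set ?L = set (\<Lambda> r)"
    using distinct_order[OF root] by (auto intro: distinct_reorder)
  have mem: "?L ! j \<in> set (\<Lambda> r)" if "j < length ?L" for j
    using nth_mem[OF that] L(2) by simp
  have root': "is_root (r @ [?L ! j]) (?L ! j)" if "j < length ?L" for j
    using root_extend[OF root mem[OF that]] .
  show ?case
  \<comment> \<open>At \<open>top\<close> the list of atoms is empty and all three conditions hold
    vacuously.\<close>
  proof (rule rao_step)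
    fix j
    assume j: "j < length ?L"
    have "u < ?L ! j" using mem[OF j] set_order[OF root] by (auto simp: covers_def)
    then have "{?L ! j..} \<subset> {u..}" by (auto simp: psubset_eq)
    then have "card {?L ! j..} < card {u..}" by (intro psubset_card_mono) auto
    then show "rao_at (reorder \<Lambda>) (r @ [?L ! j])" using less.hyps root'[OF j] by blast
  next
    fix j x y
    assume j: "j < length ?L"
      and x: "x \<in> atoms (?L ! j) top" "\<exists>k<j. ?L ! k < x"
      and y: "y \<in> atoms (?L ! j) top" "\<not> (\<exists>k<j. ?L ! k < y)"
    have "r \<noteq> []" using root by (simp add: is_root_def)
    \<comment> \<open>Being above an earlier atom of \<open>?L\<close> is exactly membership in the
      front, so (i)(b) holds by construction.\<close>
    then have "x \<in> front \<Lambda> (r @ [?L ! j])" "y \<in> set (\<Lambda> (r @ [?L ! j])) - front \<Lambda> (r @ [?L ! j])"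
      using x y set_order[OF root'[OF j]] precedes_nth[OF L(1) j] by (auto simp: front_snoc)
    then show "precedes (reorder \<Lambda> (r @ [?L ! j])) x y" by (simp add: precedes_reorder)
  next
    fix i j y
    assume i: "i < j" and j: "j < length ?L" and y: "?L ! i < y" "?L ! j < y"
    have "precedes ?L (?L ! i) (?L ! j)" using precedes_nth[OF L(1) j] i by blast
    then obtain z c where z: "z \<le> y" "?L ! j \<lessdot> z" "precedes ?L c (?L ! j)" "c < z"
      using reorder_earlier_below_cover[OF root] y by metis
    then obtain k where "k < j" "?L ! k = c" using precedes_nth[OF L(1) j] by auto
    then show "\<exists>k<j. \<exists>z. ?L ! j \<lessdot> z \<and> ?L ! k < z \<and> z \<le> y"
      using z by auto
  qed
qed

end

lemma GRAO_imp_RAO_reorder: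
  assumes "GRAO \<Lambda>"
  shows "RAO (reorder \<Lambda>)"
proof -
  interpret grao \<Lambda> by unfold_locales fact
  show ?thesis
    using rao_at_reorder[OF is_root_bot] chain_atom_ordering_reorder assms
    by (auto simp: RAO_def GRAO_def)
qed

theorem theorem4p11:
  shows "((\<exists>\<Lambda> :: 'a::{finite,order_bot,order_top} list \<Rightarrow> 'a list. GRAO \<Lambda>) \<longleftrightarrow>
          (\<exists>\<Lambda> :: 'a list \<Rightarrow> 'a list. RAO \<Lambda>)) \<and>
         (\<forall>\<Lambda> :: 'a list \<Rightarrow> 'a list. RAO \<Lambda> \<longrightarrow> GRAO \<Lambda>) \<and>
         (\<forall>\<Lambda> :: 'a list \<Rightarrow> 'a list. GRAO \<Lambda> \<longrightarrow> RAO (reorder \<Lambda>))"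
  using RAO_imp_GRAO GRAO_imp_RAO_reorder by blast

end
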